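(* For a finite connected graph $G$, the following are equivalent: (1) $G$ is $1$-loopy; (2) $G_{\mathrm{irr}}$ is strongly connected; (3) $G$ is not a cycle and every vertex of $G$ has degree at least $2$. In particular, if $G$ is connected and $d$-regular with $d\ge3$, then $G_{\mathrm{irr}}$ is strongly connected.
   Context: A graph consists of a vertex set, a set of directed edges each with an origin and a terminus, and an involution $\mathrm{opp}$ on directed edges such that $\mathrm{opp}(e)$ goes from the terminus of $e$ to its origin. Undirected edges are the orbits $\{e,\mathrm{opp}(e)\}$. A self-loop $e$ with $\mathrm{opp}(e)=e$ is a half-loop; two distinct self-loops at a vertex paired by $\mathrm{opp}$ form a whole-loop. The degree of a vertex is the number of directed edges originating there (a whole-loop contributes $2$, a half-loop $1$); $d$-regular means every vertex has degree $d$. $G_{\mathrm{irr}}$ is the directed graph whose vertices are the directed edges of $G$, with an edge from $e_1$ to $e_2$ iff $e_1$ terminates at the origin of $e_2$ and $e_2\neq\mathrm{opp}(e_1)$. A connected graph is loopy if it has at least as many (undirected) edges as vertices (equivalently, it is not a tree), and $1$-loopy if it is connected and removing any one undirected edge leaves a graph each of whose connected components is loopy. A cycle is a connected graph whose vertices and edges can be listed as $v_0,e_1,v_1,\dots,e_m,v_m=v_0$ with $v_0,\dots,v_{m-1}$ distinct, $e_1,\dots,e_m$ distinct undirected edges, $e_i$ joining $v_{i-1}$ and $v_i$, and no other edges.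
   Formalization: The equivalence is proved for graphs with at least two directed edges; it fails for the two excluded connected graphs: a single vertex with no edge (vacuously 1-loopy, degree 0) and a single vertex with one half-loop (irreducible graph is one vertex, degree 1). *)

theory Defs
  imports "Graph_Theory.Graph_Theory"
begin

text \<open>
  A graph is a digraph together with an involution of its arcs that exchanges tail and head.
  Fixed points of the involution (half-loops) are allowed, which is why the library locale
  \<open>bidirected_digraph\<close>, whose reversal map moves every arc, is not used.
\<close>

locale opp_graph = wf_digraph G for G :: "('a, 'b) pre_digraph" +
  fixes opp :: "'b \<Rightarrow> 'b"
  assumes opp_in_arcs: "e \<in> arcs G \<Longrightarrow> opp e \<in> arcs G"
    and opp_opp: "e \<in> arcs G \<Longrightarrow> opp (opp e) = e"
    and tail_opp: "e \<in> arcs G \<Longrightarrow> tail G (opp e) = head G e"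
    and head_opp: "e \<in> arcs G \<Longrightarrow> head G (opp e) = tail G e"

locale fin_opp_graph = opp_graph G opp + fin_digraph G
  for G :: "('a, 'b) pre_digraph" and opp :: "'b \<Rightarrow> 'b"

definition undirected_edges :: "('a, 'b) pre_digraph \<Rightarrow> ('b \<Rightarrow> 'b) \<Rightarrow> 'b set set" where
  "undirected_edges G opp = (\<lambda>e. {e, opp e}) ` arcs G"

text \<open>
  The degree of a vertex is the library's \<^const>\<open>out_degree\<close>.
\<close>

definition regular_graph :: "('a, 'b) pre_digraph \<Rightarrow> nat \<Rightarrow> bool" where
  "regular_graph G d \<longleftrightarrow> (\<forall>v \<in> verts G. out_degree G v = d)"

definition irr_digraph :: "('a, 'b) pre_digraph \<Rightarrow> ('b \<Rightarrow> 'b) \<Rightarrow> ('b, 'b \<times> 'b) pre_digraph" where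
  "irr_digraph G opp =
     \<lparr> verts = arcs G,
       arcs = {(e1, e2). e1 \<in> arcs G \<and> e2 \<in> arcs G \<and> head G e1 = tail G e2 \<and> e2 \<noteq> opp e1},
       tail = fst, head = snd \<rparr>"

text \<open>
  Both cardinalities below are meaningful only for finite graphs.
\<close>

definition loopy :: "('a, 'b) pre_digraph \<Rightarrow> ('b \<Rightarrow> 'b) \<Rightarrow> bool" where
  "loopy G opp \<longleftrightarrow> connected G \<and> card (undirected_edges G opp) \<ge> card (verts G)"

definition del_edge :: "('a, 'b) pre_digraph \<Rightarrow> 'b set \<Rightarrow> ('a, 'b) pre_digraph" where
  "del_edge G E = \<lparr> verts = verts G, arcs = arcs G - E, tail = tail G, head = head G \<rparr>"

definition connected_components :: "('a, 'b) pre_digraph \<Rightarrow> ('a, 'b) pre_digraph set" where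
  "connected_components G = {H. pre_digraph.max_subgraph G connected H}"

definition one_loopy :: "('a, 'b) pre_digraph \<Rightarrow> ('b \<Rightarrow> 'b) \<Rightarrow> bool" where
  "one_loopy G opp \<longleftrightarrow> connected G \<and>
     (\<forall>E \<in> undirected_edges G opp. \<forall>H \<in> connected_components (del_edge G E). loopy H opp)"

definition joins :: "('a, 'b) pre_digraph \<Rightarrow> 'b set \<Rightarrow> 'a \<Rightarrow> 'a \<Rightarrow> bool" where
  "joins G E u v \<longleftrightarrow> (\<exists>e \<in> E. tail G e = u \<and> head G e = v)"

text \<open>
  With \<open>m = length es\<close>, the list \<open>vs\<close> is $v_0, \ldots, v_{m-1}$, the list \<open>es\<close> is
  $e_1, \ldots, e_m$ (so \<open>es ! i\<close> is $e_{i+1}$), and the index modulo \<open>m\<close> encodes $v_m = v_0$.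
  The cases $m = 1$ (one self-loop) and $m = 2$ (two parallel edges) are included.
\<close>

definition is_cycle_graph :: "('a, 'b) pre_digraph \<Rightarrow> ('b \<Rightarrow> 'b) \<Rightarrow> bool" where
  "is_cycle_graph G opp \<longleftrightarrow> connected G \<and>
     (\<exists>vs es. es \<noteq> [] \<and> length vs = length es \<and> distinct vs \<and> distinct es \<and>
        set vs = verts G \<and> set es = undirected_edges G opp \<and>
        (\<forall>i < length es. joins G (es ! i) (vs ! i) (vs ! (Suc i mod length es))))"

end

theory Submission
  imports Defs
begin

text \<open>A path in \<open>irr_digraph G opp\<close> is a non-backtracking walk in
  \<open>G\<close>. Strong connectivity comes down to whether every arc reaches its own reversal: if
  turning round is always possible, connectivity of \<open>G\<close> does the rest
  (\<open>irr_reach_all\<close>). Suppose all degrees are at least 2 and \<open>e\<close> does not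
  reach \<open>opp e\<close>. Then the arcs reachable from \<open>e\<close> never include both an
  arc and its reversal, so no two of them share a head. Successors permute them in a single orbit,
  and connectivity makes this orbit all of \<open>G\<close>, a cycle
  (\<open>is_cycle_if_not_irr_reach_opp\<close>). So (3) implies (2).

  Conversely, at a vertex of degree below 2 there is a pendant arc (\<open>pendant_arc\<close>): its
  reversal is a dead end for non-backtracking walks, and deleting its edge isolates the vertex. In a
  cycle with degrees at least 2, walks are forced and never turn round
  (\<open>not_irr_reach_opp\<close>), and deleting an edge leaves a path, which is a tree. So (2)
  and (1) each imply (3). Finally (2) implies (1) by counting: a tree component left by deleting an
  edge makes every degree bound an equality, hence \<open>G\<close> is 2-regular without half-loops,
  against (2).

  The equivalences are for at least two arcs: a lone vertex is vacuously 1-loopy while its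
  \<open>irr_digraph\<close> is empty, and a lone half-loop is a cycle whose one-vertex
  \<open>irr_digraph\<close> is strongly connected.\<close>

section \<open>Connectivity, components, and counting pairs\<close>

text \<open>Replaces undirected walks by vertex sets: later arguments about connectivity only
  exhibit a set that no arc enters or leaves.\<close>

lemma (in wf_digraph) connected_iff_closed_sets:
  "connected G \<longleftrightarrow> verts G \<noteq> {} \<and>
     (\<forall>U \<subseteq> verts G. U \<noteq> {} \<longrightarrow> (\<forall>e \<in> arcs G. tail G e \<in> U \<longleftrightarrow> head G e \<in> U) \<longrightarrow> U = verts G)"
  (is "_ \<longleftrightarrow> _ \<and> ?closed")
proof -
  let ?r = "rtrancl_on (verts G) ((arcs_ends G)\<^sup>s)"
  have sym_arcs_ends: "(x, y) \<in> (arcs_ends G)\<^sup>s \<longleftrightarrow>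
      (\<exists>e \<in> arcs G. x = tail G e \<and> y = head G e \<or> x = head G e \<and> y = tail G e)" for x y
    by (auto simp: symcl_def arcs_ends_conv image_iff)
  have closed: "U = verts G"
    if U: "U \<subseteq> verts G" "U \<noteq> {}" and cl: "\<forall>e \<in> arcs G. tail G e \<in> U \<longleftrightarrow> head G e \<in> U"
      and conn: "\<forall>u \<in> verts G. \<forall>v \<in> verts G. (u, v) \<in> ?r" for U
  proof -
    obtain u where u: "u \<in> U" using U by blast
    have "v \<in> U" if "v \<in> verts G" for v
    proof -
      have "(u, v) \<in> ?r" using conn u U that by blast
      then show ?thesis
      proof (induction rule: rtrancl_on_induct)
        case base then show ?case using u by blast
      next
        case (step y z) then show ?case using cl unfolding \<open>\<And>y x. ((x, y) \<in> (arcs_ends G)\<^sup>s) = _ x y\<close> by blast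
      qed
    qed
    then show ?thesis using U by blast
  qed
  have reach: "(u, v) \<in> ?r" if c: ?closed and uv: "u \<in> verts G" "v \<in> verts G" for u v
  proof -
    let ?U = "{w. (u, w) \<in> ?r}"
    have "?U \<subseteq> verts G" by (auto dest: in_rtrancl_on_in_F)
    moreover have "?U \<noteq> {}" using uv by (auto intro: rtrancl_on_refl)
    moreover have "\<forall>e \<in> arcs G. tail G e \<in> ?U \<longleftrightarrow> head G e \<in> ?U"
    proof
      fix e assume e: "e \<in> arcs G"
      then have "(tail G e, head G e) \<in> (arcs_ends G)\<^sup>s" "(head G e, tail G e) \<in> (arcs_ends G)\<^sup>s"
        unfolding sym_arcs_ends by blast+
      then show "tail G e \<in> ?U \<longleftrightarrow> head G e \<in> ?U"
        using e by (auto intro: rtrancl_on_into_rtrancl_on)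
    qed
    ultimately have "?U = verts G" using c by blast
    then show ?thesis using uv by blast
  qed
  show ?thesis
    unfolding connected_conv
    by (rule conj_cong[OF refl], rule iffI) (use closed in simp, use reach in simp)
qed

text \<open>Otherwise the arc, together with its other end, could be added to the component.\<close>

lemma (in pre_digraph) max_connected_subgraph_arc:
  assumes H: "max_subgraph connected H" and f: "f \<in> arcs G" "tail G f \<in> verts H"
  shows "f \<in> arcs H"
proof -
  have sub: "subgraph H G" and conn: "connected H"
    and maxi: "\<And>H'. H' \<noteq> H \<Longrightarrow> subgraph H H' \<Longrightarrow> subgraph H' G \<Longrightarrow> \<not> connected H'"
    using H by (auto simp: max_subgraph_def)
  interpret wf_digraph G using sub by (simp add: subgraph_def)
  interpret H: wf_digraph H using sub by (simp add: subgraph_def)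
  have [simp]: "tail H = tail G" "head H = head G"
    and le: "verts H \<subseteq> verts G" "arcs H \<subseteq> arcs G"
    using sub by (auto simp: subgraph_def compatible_def)
  define K where "K = H.add_arc f"
  have K [simp]: "verts K = insert (head G f) (verts H)" "arcs K = insert f (arcs H)"
      "tail K = tail G" "head K = head G"
    using f by (auto simp: K_def H.add_arc_def)
  have "wf_digraph K"
    by (rule wf_digraph.intro) (use f H.tail_in_verts H.head_in_verts in auto)
  interpret K: wf_digraph K by fact
  have "subgraph H K" "subgraph K G"
    using le f wf_digraph_axioms H.wf_digraph_axioms K.wf_digraph_axioms
    by (auto simp: subgraph_def compatible_def)
  moreover have "connected K"
    unfolding K.connected_iff_closed_sets
  proof (intro conjI allI impI)
    fix U assume U: "U \<subseteq> verts K" "U \<noteq> {}"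
      and cl: "\<forall>e \<in> arcs K. tail K e \<in> U \<longleftrightarrow> head K e \<in> U"
    have fU: "tail G f \<in> U \<longleftrightarrow> head G f \<in> U" using cl by simp
    then have "U \<inter> verts H \<noteq> {}" using U f by auto
    then have "U \<inter> verts H = verts H"
      using conn cl H.tail_in_verts H.head_in_verts
      unfolding H.connected_iff_closed_sets by simp
    then show "U = verts K" using U fU f by auto
  qed simp
  ultimately have "K = H" using maxi by blast
  then show ?thesis using K(2) by blast
qed

lemma (in wf_digraph) self_in_connected_components:
  assumes "connected G"
  shows "G \<in> connected_components G"
  using assms
  by (auto simp: connected_components_def max_subgraph_def subgraph_def compatible_def wf_digraph_axioms)

text \<open>The pairs cover \<open>A\<close>; each has at most two elements, that of a fixed point
  only one. For arcs under \<open>opp\<close>, a count of exactly two arcs per edge therefore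
  excludes half-loops.\<close>

lemma card_le_twice_pairs:
  assumes "finite A"
  shows "card A \<le> 2 * card ((\<lambda>e. {e, f e}) ` A)"
    and "\<lbrakk>a \<in> A; f a = a\<rbrakk> \<Longrightarrow> card A < 2 * card ((\<lambda>e. {e, f e}) ` A)"
proof -
  let ?P = "(\<lambda>e. {e, f e}) ` A"
  have A: "card A \<le> (\<Sum>E \<in> ?P. card E)"
    using card_mono[of "\<Union> ?P" A] card_Union_le_sum_card[of ?P] assms by force
  have two: "\<forall>E \<in> ?P. card E \<le> 2" by (auto simp: card_insert_if)
  then have "(\<Sum>E \<in> ?P. card E) \<le> (\<Sum>E \<in> ?P. 2)" by (intro sum_mono) auto
  then show "card A \<le> 2 * card ?P" using A by simp
  assume a: "a \<in> A" "f a = a"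
  have "(\<Sum>E \<in> ?P. card E) < (\<Sum>E \<in> ?P. 2)"
  proof (rule sum_strict_mono_ex1)
    show "\<exists>E \<in> ?P. card E < 2" using a by (intro bexI[of _ "{a, f a}"]) auto
  qed (use assms two in auto)
  then show "card A < 2 * card ?P" using A by simp
qed

text \<open>Closure along outgoing arcs is enough here, since applying it to \<open>opp e\<close>
  gives closure backwards along \<open>e\<close>.\<close>

lemma (in opp_graph) connected_closedD:
  assumes conn: "connected G" and U: "U \<subseteq> verts G" "U \<noteq> {}"
    and cl: "\<And>e. \<lbrakk>e \<in> arcs G; tail G e \<in> U\<rbrakk> \<Longrightarrow> head G e \<in> U"
  shows "U = verts G"
proof -
  have "tail G e \<in> U \<longleftrightarrow> head G e \<in> U" if e: "e \<in> arcs G" for e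
    using cl[OF e] cl[OF opp_in_arcs[OF e]] by (auto simp: tail_opp head_opp e)
  then show ?thesis using conn U unfolding connected_iff_closed_sets by blast
qed

section \<open>Non-backtracking walks and when an arc reaches its reversal\<close>

context fin_opp_graph
begin

abbreviation irr_steps :: "'b rel" where
  "irr_steps \<equiv> arcs (irr_digraph G opp)"

lemma irr_steps_iff:
  "(e, f) \<in> irr_steps \<longleftrightarrow> e \<in> arcs G \<and> f \<in> arcs G \<and> head G e = tail G f \<and> f \<noteq> opp e"
  by (simp add: irr_digraph_def)

lemma strongly_connected_irr_iff:
  "strongly_connected (irr_digraph G opp) \<longleftrightarrow>
     arcs G \<noteq> {} \<and> (\<forall>e \<in> arcs G. \<forall>f \<in> arcs G. (e, f) \<in> irr_steps\<^sup>*)"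
proof -
  interpret I: wf_digraph "irr_digraph G opp"
    by unfold_locales (auto simp: irr_digraph_def)
  have "verts (irr_digraph G opp) = arcs G" by (simp add: irr_digraph_def)
  moreover have "arcs_ends (irr_digraph G opp) = irr_steps"
    by (auto simp: arcs_ends_conv irr_digraph_def)
  ultimately show ?thesis
    unfolding strongly_connected_def by (auto simp: I.reachable_conv')
qed

lemma irr_steps_rev: "(e, f) \<in> irr_steps \<Longrightarrow> (opp f, opp e) \<in> irr_steps"
  unfolding irr_steps_iff by (metis head_opp opp_in_arcs opp_opp tail_opp)

lemma irr_reach_rev: "(e, f) \<in> irr_steps\<^sup>* \<Longrightarrow> (opp f, opp e) \<in> irr_steps\<^sup>*"
  by (induction rule: rtrancl_induct) (auto intro: converse_rtrancl_into_rtrancl irr_steps_rev)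

lemma irr_reach_in_arcs: "(e, f) \<in> irr_steps\<^sup>* \<Longrightarrow> e \<in> arcs G \<Longrightarrow> f \<in> arcs G"
  by (induction rule: rtrancl_induct) (auto simp: irr_steps_iff)

lemma ex_irr_step:
  assumes "e \<in> arcs G" "2 \<le> out_degree G (head G e)"
  shows "\<exists>f. (e, f) \<in> irr_steps"
proof -
  have "\<not> out_arcs G (head G e) \<subseteq> {opp e}"
    using assms card_mono[of "{opp e}" "out_arcs G (head G e)"] by (auto simp: out_degree_def)
  then show ?thesis using assms by (auto simp: irr_steps_iff)
qed

text \<open>When turning round is always possible, the ban on backtracking costs nothing: once an
  arc is reached, so is every arc leaving its head. The vertices whose outgoing arcs are all reached
  from \<open>e\<close> thus form a closed set containing the head of \<open>e\<close>.\<close>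

lemma irr_reach_all:
  assumes conn: "connected G" and opp: "\<And>e. e \<in> arcs G \<Longrightarrow> (e, opp e) \<in> irr_steps\<^sup>*"
    and "arcs G \<noteq> {}"
  shows "strongly_connected (irr_digraph G opp)"
proof -
  have "(e, f) \<in> irr_steps\<^sup>*" if e: "e \<in> arcs G" and f: "f \<in> arcs G" for e f
  proof -
    let ?U = "{w \<in> verts G. \<forall>g \<in> arcs G. tail G g = w \<longrightarrow> (e, g) \<in> irr_steps\<^sup>*}"
    have next_arcs: "(e, h) \<in> irr_steps\<^sup>*"
      if "(e, g) \<in> irr_steps\<^sup>*" "g \<in> arcs G" "h \<in> arcs G" "tail G h = head G g" for g h
    proof (cases "h = opp g")
      case True then show ?thesis using that opp rtrancl_trans by metis
    next
      case False
      then have "(g, h) \<in> irr_steps" using that by (simp add: irr_steps_iff)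
      then show ?thesis using that by simp
    qed
    have cl: "head G g \<in> ?U" if "g \<in> arcs G" "tail G g \<in> ?U" for g
      using that next_arcs[of g] by auto
    have "head G e \<in> ?U" using next_arcs[of e] e by auto
    then have "?U = verts G" using cl by (intro connected_closedD[OF conn]) blast+
    then show ?thesis using f tail_in_verts by blast
  qed
  then show ?thesis using assms by (simp add: strongly_connected_irr_iff)
qed

text \<open>
  A set of arcs that never meets its own reversal cannot contain two arcs with the same head,
  since one of them could be followed by the reversal of the other. So on the arcs reachable from
  \<open>e\<close>, choosing a successor is injective, hence a permutation, whose only orbit lists the cycle.
\<close>

lemma is_cycle_if_not_irr_reach_opp:
  assumes conn: "connected G" and deg: "\<And>v. v \<in> verts G \<Longrightarrow> 2 \<le> out_degree G v"
    and e: "e \<in> arcs G" and not_opp: "(e, opp e) \<notin> irr_steps\<^sup>*"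
  shows "is_cycle_graph G opp"
proof -
  define R where "R = irr_steps\<^sup>* `` {e}"
  have eR: "e \<in> R" by (simp add: R_def)
  have RA: "R \<subseteq> arcs G" using e irr_reach_in_arcs by (auto simp: R_def)
  have finR: "finite R" using RA finite_subset finite_arcs by blast
  have Rstep: "g \<in> R" if "f \<in> R" "(f, g) \<in> irr_steps" for f g
    using that by (auto simp: R_def)
  \<comment> \<open>The walk from \<open>e\<close> to \<open>f\<close>, reversed, leads from
    \<open>opp f\<close> to \<open>opp e\<close>; so reaching both \<open>f\<close> and
    \<open>opp f\<close> would mean reaching \<open>opp e\<close>.\<close>
  have Ropp: "opp f \<notin> R" if "f \<in> R" for f
  proof
    assume "opp f \<in> R"
    moreover have "(opp f, opp e) \<in> irr_steps\<^sup>*" using that irr_reach_rev by (simp add: R_def)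
    ultimately show False using not_opp rtrancl_trans by (fastforce simp: R_def)
  qed
  have head_inj: "f = g" if "f \<in> R" "g \<in> R" "head G f = head G g" for f g
  proof (rule ccontr)
    assume "f \<noteq> g"
    then have "opp g \<noteq> opp f" using that RA opp_opp by (metis subsetD)
    then have "(f, opp g) \<in> irr_steps"
      using that RA by (auto simp: irr_steps_iff opp_in_arcs tail_opp)
    then show False using Rstep Ropp that by blast
  qed
  \<comment> \<open>Extending by the identity outside \<open>R\<close> makes \<open>s\<close>
    injective on the whole type, as \<open>funpow_inj_finite\<close> needs.\<close>
  define s where "s f = (if f \<in> R then SOME g. (f, g) \<in> irr_steps else f)" for f
  have s_step: "(f, s f) \<in> irr_steps" if "f \<in> R" for f
    using someI_ex[OF ex_irr_step[of f]] that RA deg by (auto simp: s_def)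
  then have sR: "s f \<in> R" if "f \<in> R" for f using that Rstep by blast
  have tail_s: "tail G (s f) = head G f" if "f \<in> R" for f
    using s_step[OF that] by (simp add: irr_steps_iff)
  have inj_R: "inj_on s R"
    by (rule inj_onI) (metis head_inj tail_s)
  have "inj s"
  proof (rule injI)
    fix f g assume "s f = s g"
    then show "f = g" using inj_R sR unfolding inj_on_def by (metis s_def)
  qed
  \<comment> \<open>An injective self-map of a finite set is onto, so each arc of \<open>R\<close>
    has a predecessor in \<open>R\<close>; this transfers \<open>head_inj\<close> to tails.\<close>
  have surj: "\<exists>f \<in> R. g = s f" if "g \<in> R" for g
    using endo_inj_surj[OF finR _ inj_R] sR that by blast
  have tail_inj: "f = g" if "f \<in> R" "g \<in> R" "tail G f = tail G g" for f g
    using surj[OF that(1)] surj[OF that(2)] that(3) head_inj tail_s by metis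

  have pow_R: "(s ^^ n) e \<in> R" for n
    by (induction n) (auto simp: eR sR)
  have "finite {y. \<exists>n. y = (s ^^ n) e}" using pow_R finR by (auto intro: finite_subset)
  then obtain n where "0 < n" "(s ^^ n) e = e" using funpow_inj_finite[OF \<open>inj s\<close>] by blast
  then have orb: "e \<in> orbit s e" unfolding orbit_altdef by force
  \<comment> \<open>The least positive number of steps after which \<open>s\<close> returns to
    \<open>e\<close>: the length of the cycle.\<close>
  define m where "m = funpow_dist1 s e e"
  define a where "a n = (s ^^ n) e" for n
  have aR: "a i \<in> R" for i using pow_R by (simp add: a_def)
  have a_m: "a m = e" using funpow_dist1_prop[OF orb] by (simp add: a_def m_def)
  have a_Suc: "a (Suc i) = s (a i)" for i by (simp add: a_def)
  have "0 < m" by (simp add: m_def)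
  have a_inj: "inj_on a {0..<m}"
    using inj_on_funpow_dist1[OF orb] by (simp add: a_def[abs_def] m_def)
  \<comment> \<open>By \<open>tail_inj\<close> the only successor of \<open>f\<close> in
    \<open>R\<close> is \<open>s f\<close>, so every walk from \<open>e\<close> follows the
    orbit.\<close>
  have "R \<subseteq> orbit s e"
  proof
    fix f assume "f \<in> R"
    then have "(e, f) \<in> irr_steps\<^sup>*" by (simp add: R_def)
    then have "f \<in> R \<and> f \<in> orbit s e"
    proof (induction rule: rtrancl_induct)
      case base show ?case using eR orb by blast
    next
      case (step f g)
      then have "g \<in> R" using Rstep by blast
      moreover have "tail G g = tail G (s f)" using step tail_s by (simp add: irr_steps_iff)
      ultimately have "g = s f" using tail_inj sR step by blast
      then show ?case using step \<open>g \<in> R\<close> by (simp add: orbit.step)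
    qed
    then show "f \<in> orbit s e" ..
  qed
  moreover have "orbit s e = a ` {0..<m}"
    using orbit_conv_funpow_dist1[OF orb] by (simp add: a_def[abs_def] m_def)
  ultimately have R_eq: "R = a ` {0..<m}" using aR by blast

  have cl: "head G f \<in> head G ` R" if f: "f \<in> arcs G" "tail G f \<in> head G ` R" for f
  proof -
    obtain g where g: "g \<in> R" "tail G f = head G g" using f by blast
    show ?thesis
    proof (cases "f = opp g")
      \<comment> \<open>Backtracking along \<open>g\<close> ends at the tail of \<open>g\<close>,
        which is the head of its predecessor.\<close>
      case True
      obtain h where "h \<in> R" "g = s h" using surj g by blast
      then show ?thesis using True g tail_s RA head_opp by (metis image_eqI subsetD)
    next
      case False
      then have "(g, f) \<in> irr_steps" using f g RA by (auto simp: irr_steps_iff)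
      then show ?thesis using g Rstep by blast
    qed
  qed
  have "head G ` R \<subseteq> verts G" "head G ` R \<noteq> {}" using RA eR by auto
  then have head_R: "head G ` R = verts G" using cl by (rule connected_closedD[OF conn])
  have tail_R: "tail G ` R = verts G"
    unfolding head_R[symmetric]
  proof
    show "tail G ` R \<subseteq> head G ` R" using surj tail_s by force
    show "head G ` R \<subseteq> tail G ` R" using sR tail_s by (metis image_subsetI rev_image_eqI)
  qed
  have arcs_R: "f \<in> R \<or> opp f \<in> R" if f: "f \<in> arcs G" for f
  proof -
    obtain g where g: "g \<in> R" "tail G f = head G g" using f head_R tail_in_verts by blast
    show ?thesis
    proof (cases "f = opp g")
      case True then show ?thesis using g RA opp_opp by auto
    next
      case False
      then have "(g, f) \<in> irr_steps" using f g RA by (auto simp: irr_steps_iff)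
      then show ?thesis using g Rstep by blast
    qed
  qed

  let ?vs = "map (\<lambda>i. tail G (a i)) [0..<m]"
  let ?es = "map (\<lambda>i. {a i, opp (a i)}) [0..<m]"
  show ?thesis
    unfolding is_cycle_graph_def
  proof (intro conjI exI[of _ ?vs] exI[of _ ?es] allI impI)
    show "?es \<noteq> []" using \<open>0 < m\<close> by simp
    show "distinct ?vs"
      using a_inj aR tail_inj by (auto simp: distinct_map inj_on_def)
    have "a i = a j" if "{a i, opp (a i)} = {a j, opp (a j)}" for i j
      using that aR Ropp by (metis doubleton_eq_iff)
    then show "distinct ?es"
      using a_inj by (auto simp: distinct_map inj_on_def)
    show "set ?vs = verts G" using tail_R R_eq by (simp add: image_image)
    have "{f, opp f} \<in> (\<lambda>f. {f, opp f}) ` R" if "f \<in> arcs G" for f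
      using arcs_R[OF that]
    proof
      assume "opp f \<in> R"
      then show ?thesis
        by (rule rev_image_eqI) (simp add: opp_opp[OF that] insert_commute)
    qed blast
    then have "(\<lambda>f. {f, opp f}) ` arcs G = (\<lambda>f. {f, opp f}) ` R" using RA by blast
    then show "set ?es = undirected_edges G opp"
      by (simp add: undirected_edges_def R_eq image_image)
    fix i assume "i < length ?es"
    then have i: "i < m" by simp
    \<comment> \<open>At the last index the list closes up because
      \<open>a m = e = a 0\<close>.\<close>
    have "a (Suc i mod m) = s (a i)"
      using i a_Suc[of i] a_m by (cases "Suc i = m") (auto simp: a_def)
    then have "tail G (a (Suc i mod m)) = head G (a i)" using tail_s aR by simp
    then show "joins G (?es ! i) (?vs ! i) (?vs ! (Suc i mod length ?es))"
      using i by (auto simp: joins_def)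
  qed (use conn in auto)
qed

text \<open>
  With a unique successor, a non-backtracking walk from \<open>e\<close> to \<open>opp e\<close> reads the same backwards;
  its middle would be a half-loop or a backtracking step.
\<close>

lemma not_irr_reach_opp:
  assumes deg: "\<And>v. v \<in> verts G \<Longrightarrow> out_degree G v = 2"
    and no_half: "\<And>f. f \<in> arcs G \<Longrightarrow> opp f \<noteq> f" and e: "e \<in> arcs G"
  shows "(e, opp e) \<notin> irr_steps\<^sup>*"
proof -
  \<comment> \<open>Of the two arcs leaving the head of \<open>f\<close>, one is
    \<open>opp f\<close>.\<close>
  have uniq: "g = h" if g: "(f, g) \<in> irr_steps" and h: "(f, h) \<in> irr_steps" for f g h
  proof -
    have f: "f \<in> arcs G" using g by (simp add: irr_steps_iff)
    then have "card (out_arcs G (head G f)) = 2" using deg by (simp add: out_degree_def)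
    moreover have "opp f \<in> out_arcs G (head G f)" "g \<in> out_arcs G (head G f)"
      "h \<in> out_arcs G (head G f)" "g \<noteq> opp f" "h \<noteq> opp f"
      using f g h by (auto simp: irr_steps_iff opp_in_arcs tail_opp)
    ultimately show ?thesis unfolding card_2_iff by (metis insertE singletonD)
  qed
  have "(e, opp e) \<notin> irr_steps ^^ k" if "e \<in> arcs G" for e k
    using that
  proof (induction k arbitrary: e rule: less_induct)
    case (less k)
    show ?case
    proof
      assume reach: "(e, opp e) \<in> irr_steps ^^ k"
      consider "k = 0" | "k = 1" | j where "k = Suc (Suc j)"
        by (metis One_nat_def not0_implies_Suc)
      then show False
      proof cases
        case 1 then show ?thesis using reach no_half[OF less.prems] by simp
      next
        case 2 then show ?thesis using reach by (simp add: irr_steps_iff)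
      next
        case 3
        then obtain a b where a: "(e, a) \<in> irr_steps" and ab: "(a, b) \<in> irr_steps ^^ j"
          and b: "(b, opp e) \<in> irr_steps"
          using reach by (meson relpow_Suc_D2 relpow_Suc_E)
        have bA: "b \<in> arcs G" "a \<in> arcs G" using a b by (auto simp: irr_steps_iff)
        \<comment> \<open>Reversing the last step gives a second successor of \<open>e\<close>, so
          \<open>opp b = a\<close>: stripping both end steps leaves a walk from \<open>a\<close> to
          \<open>opp a\<close>, shorter by two.\<close>
        have "(e, opp b) \<in> irr_steps" using irr_steps_rev[OF b] opp_opp less.prems by simp
        then have "b = opp a" using uniq a bA opp_opp by metis
        then show ?thesis using less.IH[of j a] 3 ab bA by simp
      qed
    qed
  qed
  then show ?thesis using e by (auto simp: rtrancl_power)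
qed

section \<open>Degree counts and pendant arcs\<close>

lemma card_out_arcs_UN:
  assumes "W \<subseteq> verts G"
  shows "card {e \<in> arcs G. tail G e \<in> W} = (\<Sum>w \<in> W. out_degree G w)"
proof -
  have "{e \<in> arcs G. tail G e \<in> W} = (\<Union>w \<in> W. out_arcs G w)" by auto
  then show ?thesis
    unfolding out_degree_def
    by (simp only:) (intro card_UN_disjoint; use finite_subset[OF assms] in auto)
qed

text \<open>The arcs leaving \<open>W\<close> number the sum of its degrees, so a total of at most
  twice \<open>card W\<close> leaves no slack at any vertex.\<close>

lemma out_degree_eq_two:
  assumes W: "W \<subseteq> verts G" and deg: "\<And>w. w \<in> W \<Longrightarrow> 2 \<le> out_degree G w"
    and le: "card {e \<in> arcs G. tail G e \<in> W} \<le> 2 * card W"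
  shows "card {e \<in> arcs G. tail G e \<in> W} = 2 * card W"
    and "\<And>w. w \<in> W \<Longrightarrow> out_degree G w = 2"
proof -
  have fin: "finite W" using W finite_verts finite_subset by blast
  have "(\<Sum>w \<in> W. 2) \<le> (\<Sum>w \<in> W. out_degree G w)" using deg by (rule sum_mono)
  then show eq: "card {e \<in> arcs G. tail G e \<in> W} = 2 * card W"
    using le card_out_arcs_UN[OF W] by simp
  fix w assume w: "w \<in> W"
  show "out_degree G w = 2"
  proof (rule ccontr)
    assume "out_degree G w \<noteq> 2"
    then have "2 < out_degree G w" using deg[OF w] by simp
    then have "(\<Sum>w \<in> W. 2) < (\<Sum>w \<in> W. out_degree G w)"
      using w deg fin by (intro sum_strict_mono_ex1) auto
    then show False using eq card_out_arcs_UN[OF W] by simp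
  qed
qed

text \<open>A cycle has as many edges as vertices, so both counting bounds are tight. The degree
  hypothesis excludes the lone half-loop, which is a cycle too.\<close>

lemma is_cycle_regular:
  assumes cyc: "is_cycle_graph G opp" and deg: "\<And>v. v \<in> verts G \<Longrightarrow> 2 \<le> out_degree G v"
  shows "\<And>v. v \<in> verts G \<Longrightarrow> out_degree G v = 2" and "\<And>f. f \<in> arcs G \<Longrightarrow> opp f \<noteq> f"
proof -
  have und: "card ((\<lambda>e. {e, opp e}) ` arcs G) = card (verts G)"
    using cyc unfolding is_cycle_graph_def undirected_edges_def by (metis distinct_card)
  have arcs_eq: "{e \<in> arcs G. tail G e \<in> verts G} = arcs G" by auto
  have "card (arcs G) \<le> 2 * card (verts G)"
    using card_le_twice_pairs(1)[of "arcs G" opp] und by simp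
  note two = out_degree_eq_two[of "verts G", unfolded arcs_eq, OF subset_refl deg this]
  show "out_degree G v = 2" if "v \<in> verts G" for v using two(2)[OF _ that] by blast
  show "opp f \<noteq> f" if "f \<in> arcs G" for f
    using card_le_twice_pairs(2)[of "arcs G" f opp] und two(1) that by auto
qed

text \<open>If only loops left \<open>v\<close>, connectivity would make \<open>v\<close> the only
  vertex and its degree the number of all arcs, at least 2.\<close>

lemma pendant_arc:
  assumes conn: "connected G" and arcs: "2 \<le> card (arcs G)"
    and v: "v \<in> verts G" and deg: "out_degree G v < 2"
  obtains e where "out_arcs G v = {e}" "head G e \<noteq> v"
proof -
  have not_closed: "\<exists>e \<in> out_arcs G v. head G e \<noteq> v"
  proof (rule ccontr)
    assume neg: "\<not> ?thesis"
    have "{v} = verts G" by (rule connected_closedD[OF conn]) (use v neg in auto)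
    then have "out_arcs G v = arcs G" using tail_in_verts by fastforce
    then show False using arcs deg by (simp add: out_degree_def)
  qed
  then obtain e where e: "e \<in> out_arcs G v" "head G e \<noteq> v" by blast
  then have "out_degree G v \<noteq> 0" unfolding out_degree_def using finite_out_arcs by (metis card_eq_0_iff empty_iff)
  then have "card (out_arcs G v) = 1" using deg by (simp add: out_degree_def)
  then show ?thesis using e that by (metis card_1_singletonE singletonD)
qed

section \<open>Strong connectivity, minimum degree and cycles\<close>

text \<open>The reversal of a pendant arc \<open>e\<close> is a dead end: the only arc leaving
  \<open>v\<close> is \<open>e\<close>, and following it would backtrack.\<close>

lemma strongly_connected_irr_degree:
  assumes conn: "connected G" and arcs: "2 \<le> card (arcs G)"
    and sc: "strongly_connected (irr_digraph G opp)" and v: "v \<in> verts G"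
  shows "2 \<le> out_degree G v"
proof (rule ccontr)
  assume "\<not> ?thesis"
  then obtain e where e: "out_arcs G v = {e}" "head G e \<noteq> v"
    using pendant_arc[OF conn arcs v] by auto
  then have eA: "e \<in> arcs G" "tail G e = v" using in_out_arcs_conv[of e G v] by auto
  then have "(opp e, e) \<in> irr_steps\<^sup>*"
    using sc opp_in_arcs by (simp add: strongly_connected_irr_iff)
  then show False
  proof (cases rule: converse_rtranclE)
    case base then show ?thesis using e eA tail_opp by metis
  next
    case (step f)
    then have "f \<in> out_arcs G v" "f \<noteq> e"
      using eA by (auto simp: irr_steps_iff head_opp opp_opp)
    then show ?thesis using e by simp
  qed
qed

lemma not_strongly_connected_irr:
  assumes "\<And>v. v \<in> verts G \<Longrightarrow> out_degree G v = 2" "\<And>f. f \<in> arcs G \<Longrightarrow> opp f \<noteq> f"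
  shows "\<not> strongly_connected (irr_digraph G opp)"
  using not_irr_reach_opp[OF assms] opp_in_arcs by (auto simp: strongly_connected_irr_iff)

lemma strongly_connected_irr_iff_not_cycle:
  assumes conn: "connected G" and arcs: "2 \<le> card (arcs G)"
  shows "strongly_connected (irr_digraph G opp) \<longleftrightarrow>
           \<not> is_cycle_graph G opp \<and> (\<forall>v \<in> verts G. 2 \<le> out_degree G v)"
proof
  assume sc: "strongly_connected (irr_digraph G opp)"
  then have "\<forall>v \<in> verts G. 2 \<le> out_degree G v"
    using strongly_connected_irr_degree[OF conn arcs] by blast
  then show "\<not> is_cycle_graph G opp \<and> (\<forall>v \<in> verts G. 2 \<le> out_degree G v)"
    using sc is_cycle_regular not_strongly_connected_irr by blast
next
  assume "\<not> is_cycle_graph G opp \<and> (\<forall>v \<in> verts G. 2 \<le> out_degree G v)"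
  then have "(e, opp e) \<in> irr_steps\<^sup>*" if "e \<in> arcs G" for e
    using is_cycle_if_not_irr_reach_opp[OF conn _ that] by blast
  then show "strongly_connected (irr_digraph G opp)"
    using irr_reach_all[OF conn] arcs by force
qed

section \<open>Deleting an edge and 1-loopiness\<close>

lemma wf_del_edge: "wf_digraph (del_edge G E)"
  by unfold_locales (auto simp: del_edge_def)

text \<open>
  A tree component of \<open>G - E\<close> would have degree sum in \<open>G\<close> at most twice its order, even
  with both ends of \<open>E\<close> in it. So the component is all of \<open>G\<close> and \<open>G\<close> is 2-regular without
  half-loops.
\<close>

lemma strongly_connected_irr_imp_one_loopy:
  assumes conn: "connected G" and arcs: "2 \<le> card (arcs G)"
    and sc: "strongly_connected (irr_digraph G opp)"
  shows "one_loopy G opp"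
  unfolding one_loopy_def
proof (intro conjI ballI conn)
  fix E H assume E: "E \<in> undirected_edges G opp" and HC: "H \<in> connected_components (del_edge G E)"
  let ?D = "del_edge G E"
  have H: "pre_digraph.max_subgraph ?D connected H" using HC by (simp add: connected_components_def)
  have connH: "connected H" and sub: "subgraph H ?D"
    using H by (auto simp: pre_digraph.max_subgraph_def)
  interpret H: wf_digraph H using sub by (simp add: subgraph_def)
  have [simp]: "tail H = tail G" "head H = head G"
    and le: "verts H \<subseteq> verts G" "arcs H \<subseteq> arcs G - E"
    using sub by (auto simp: subgraph_def compatible_def del_edge_def)
  obtain e where e: "e \<in> arcs G" "E = {e, opp e}" using E by (auto simp: undirected_edges_def)
  have EA: "E \<subseteq> arcs G" and Eopp: "\<And>f. f \<in> E \<Longrightarrow> opp f \<in> E"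
    using e opp_in_arcs opp_opp by auto
  have finH: "finite (arcs H)" "finite E" using le e finite_subset[of "arcs H" "arcs G"] by auto
  let ?W = "verts H"
  let ?B = "{f \<in> arcs G. tail G f \<in> ?W}"
  have arc_H: "f \<in> arcs H" if "f \<in> ?B" "f \<notin> E" for f
    using pre_digraph.max_connected_subgraph_arc[OF H] that by (simp add: del_edge_def)
  have deg: "2 \<le> out_degree G v" if "v \<in> verts G" for v
    using strongly_connected_irr_degree[OF conn arcs sc that] .
  show "loopy H opp"
  proof (rule ccontr)
    assume "\<not> loopy H opp"
    then have und: "card ((\<lambda>e. {e, opp e}) ` arcs H) < card ?W"
      using connH by (simp add: loopy_def undirected_edges_def)
    have "?B \<subseteq> arcs H \<union> (?B \<inter> E)" using arc_H by blast
    then have cardB: "card ?B \<le> card (arcs H) + card (?B \<inter> E)"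
      using finH by (meson card_Un_le card_mono finite_Int finite_UnI le_trans)
    have cardE: "card (?B \<inter> E) \<le> card E" "card E \<le> 2"
      using card_mono[OF finH(2), of "?B \<inter> E"] e(2) by (simp_all only: Int_lower2) (simp add: card_insert_if)
    note arcsH = card_le_twice_pairs[OF finH(1), where f = opp]
    \<comment> \<open>The bound is \<open>2 * (card ?W - 1)\<close> from the arcs of
      \<open>H\<close> plus 2 from \<open>E\<close>. The lower bound on degrees then makes each of
      these estimates an equality.\<close>
    have "card ?B \<le> 2 * card ?W" using cardB cardE arcsH(1) und by linarith
    note two = out_degree_eq_two[OF le(1) deg[OF subsetD[OF le(1)]] this]
    have "card (?B \<inter> E) = card E" and E2: "card E = 2"
      using two(1) cardB cardE arcsH(1) und by linarith+
    then have EB: "E \<subseteq> ?B" using finH card_subset_eq[of E "?B \<inter> E"] by blast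
    have no_half_H: "opp f \<noteq> f" if "f \<in> arcs H" for f
      using arcsH(2)[OF that] two(1) cardB cardE und by linarith
    have no_half_E: "opp f \<noteq> f" if "f \<in> E" for f
      using that E2 e opp_opp by auto
    have cl: "head G f \<in> ?W" if "f \<in> arcs G" "tail G f \<in> ?W" for f
    proof (cases "f \<in> E")
      case True
      then have "opp f \<in> ?B" using EB Eopp by blast
      then show ?thesis using that tail_opp by simp
    next
      case False
      then show ?thesis using arc_H[of f] H.head_in_verts[of f] that by simp
    qed
    have "?W \<noteq> {}" using connH H.connected_iff_closed_sets by blast
    with le(1) have W: "?W = verts G" using cl by (rule connected_closedD[OF conn])
    then have "opp f \<noteq> f" if "f \<in> arcs G" for f
      using that arc_H[of f] no_half_H no_half_E tail_in_verts by blast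
    then show False using not_strongly_connected_irr sc two(2) W by auto
  qed
qed

text \<open>Deleting the edge of a pendant arc isolates its tail, and a single vertex without edges
  is not loopy.\<close>

lemma one_loopy_degree:
  assumes conn: "connected G" and arcs: "2 \<le> card (arcs G)"
    and loopy: "one_loopy G opp" and v: "v \<in> verts G"
  shows "2 \<le> out_degree G v"
proof (rule ccontr)
  assume "\<not> ?thesis"
  then obtain e where e: "out_arcs G v = {e}" "head G e \<noteq> v"
    using pendant_arc[OF conn arcs v] by auto
  then have eA: "e \<in> arcs G" "tail G e = v" using in_out_arcs_conv[of e G v] by auto
  define D where "D = del_edge G {e, opp e}"
  define H where "H = \<lparr>verts = {v}, arcs = {}, tail = tail G, head = head G\<rparr>"
  have D: "verts D = verts G" "arcs D = arcs G - {e, opp e}" "tail D = tail G" "head D = head G"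
    by (auto simp: D_def del_edge_def)
  have no_out: "tail G f \<noteq> v" if "f \<in> arcs D" for f
  proof
    assume "tail G f = v"
    then have "f \<in> out_arcs G v" using that D by simp
    then show False using e that D by simp
  qed
  have no_in: "head G f \<noteq> v" if "f \<in> arcs D" for f
  proof -
    have "opp f \<in> arcs D" using that D opp_in_arcs opp_opp eA by (metis DiffD1 DiffD2 DiffI insertE insertI1 insertI2 singletonD)
    then show ?thesis using no_out tail_opp that D by (metis DiffD1)
  qed
  have wfH: "wf_digraph H" by unfold_locales (auto simp: H_def)
  then have connH: "connected H"
    by (subst wf_digraph.connected_iff_closed_sets) (auto simp: H_def)
  have "pre_digraph.max_subgraph D connected H"
  proof (rule pre_digraph.max_subgraphI)
    show "subgraph H D"
      using wfH wf_del_edge v by (simp add: subgraph_def compatible_def D) (simp add: H_def D_def)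
    fix K assume K: "H \<noteq> K" "subgraph H K" "subgraph K D"
    have wfK: "wf_digraph K" and TK: "tail K = tail G" "head K = head G"
      and leK: "arcs K \<subseteq> arcs D" "v \<in> verts K"
      using K by (auto simp: subgraph_def compatible_def D H_def)
    show "\<not> connected K"
    proof
      assume "connected K"
      \<comment> \<open>No arc of \<open>D\<close> touches \<open>v\<close>, so \<open>{v}\<close>
        is closed in \<open>K\<close>.\<close>
      then have VK: "{v} = verts K"
        unfolding wf_digraph.connected_iff_closed_sets[OF wfK]
        using leK no_out no_in TK by (elim conjE allE[of _ "{v}"]) auto
      have "arcs K = {}"
        using VK leK no_out TK wf_digraph.tail_in_verts[OF wfK] by fastforce
      then have "H = K" using VK TK by (simp add: H_def)
      then show False using K by blast
    qed
  qed (rule connH)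
  then have "loopy H opp"
    using loopy eA by (auto simp: one_loopy_def undirected_edges_def connected_components_def D_def)
  then show False by (simp add: loopy_def undirected_edges_def H_def)
qed

text \<open>Deleting one edge leaves a path: still connected, but with one edge fewer than
  vertices.\<close>

lemma one_loopy_not_cycle:
  assumes loopy: "one_loopy G opp"
  shows "\<not> is_cycle_graph G opp"
proof
  assume "is_cycle_graph G opp"
  then obtain vs es where ne: "es \<noteq> []" and len: "length vs = length es"
    and dist: "distinct vs" "distinct es" and vs: "set vs = verts G"
    and es: "set es = undirected_edges G opp"
    and joins: "\<And>i. i < length es \<Longrightarrow> joins G (es ! i) (vs ! i) (vs ! (Suc i mod length es))"
    unfolding is_cycle_graph_def by blast
  define m where "m = length es"
  define D where "D = del_edge G (es ! 0)"
  have "0 < m" using ne by (simp add: m_def)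
  then have E: "es ! 0 \<in> undirected_edges G opp" using es nth_mem by (simp add: m_def flip: es)
  have D: "verts D = verts G" "arcs D = arcs G - es ! 0" "tail D = tail G" "head D = head G"
    by (auto simp: D_def del_edge_def)
  interpret D: wf_digraph D using wf_del_edge by (simp add: D_def)
  \<comment> \<open>Undirected edges are disjoint orbits, so deleting \<open>es ! 0\<close> removes
    no arc of another edge.\<close>
  have orbit_eq: "F = {f, opp f}" if "F \<in> undirected_edges G opp" "f \<in> F" for F f
    using that opp_opp by (auto simp: undirected_edges_def)
  have edge_D: "\<exists>f \<in> arcs D. tail G f = vs ! i \<and> head G f = vs ! (Suc i mod m)"
    if i: "0 < i" "i < m" for i
  proof -
    obtain f where f: "f \<in> es ! i" "tail G f = vs ! i" "head G f = vs ! (Suc i mod m)"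
      using joins[of i] i by (auto simp: joins_def m_def)
    have Ei: "es ! i \<in> undirected_edges G opp" using es nth_mem i by (simp add: m_def flip: es)
    then have "f \<in> arcs G" using f opp_in_arcs by (auto simp: undirected_edges_def)
    moreover have "f \<notin> es ! 0"
    proof
      assume "f \<in> es ! 0"
      then have "es ! 0 = es ! i" using orbit_eq E Ei f by metis
      then show False using dist i \<open>0 < m\<close> by (simp add: nth_eq_iff_index_eq m_def)
    qed
    ultimately show ?thesis using f D by blast
  qed
  have "connected D"
    unfolding D.connected_iff_closed_sets
  proof (intro conjI allI impI)
    show "verts D \<noteq> {}" using D vs ne len by auto
    fix U assume U: "U \<subseteq> verts D" "U \<noteq> {}"
      and cl: "\<forall>e \<in> arcs D. tail D e \<in> U \<longleftrightarrow> head D e \<in> U"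
    \<comment> \<open>Only the step from index 0 to 1 is lost with \<open>es ! 0\<close>; membership
      in \<open>U\<close> still propagates from 1 up to \<open>m\<close>, which the modulus
      identifies with 0.\<close>
    define P where "P i \<longleftrightarrow> vs ! (i mod m) \<in> U" for i
    have P_step: "P i \<longleftrightarrow> P (Suc i)" if "0 < i" "i < m" for i
      using edge_D[OF that] cl that unfolding D P_def by (metis mod_less)
    have P1: "P (Suc i) \<longleftrightarrow> P 1" if "i < m" for i
      using that
    proof (induction i)
      case (Suc i) then show ?case using P_step[of "Suc i"] by simp
    qed simp
    have P0: "P i \<longleftrightarrow> P 1" if "i < m" for i
    proof (cases i)
      case 0
      then show ?thesis using P1[of "m - 1"] \<open>0 < m\<close> by (simp add: P_def)
    next
      case (Suc j) then show ?thesis using P1[of j] that by simp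
    qed
    have P_nth: "vs ! i \<in> U \<longleftrightarrow> P 1" if "i < m" for i using P0[OF that] that by (simp add: P_def)
    have in_vs: "w \<in> verts G \<longleftrightarrow> (\<exists>i < m. w = vs ! i)" for w
      using vs len by (metis in_set_conv_nth m_def)
    have "P 1" using U D in_vs P_nth by (metis all_not_in_conv subsetD)
    then have "verts D \<subseteq> U" using D in_vs P_nth by auto
    then show "U = verts D" using U by blast
  qed
  then have "D \<in> connected_components D" by (rule D.self_in_connected_components)
  then have "loopy D opp" using loopy E by (simp add: one_loopy_def D_def)
  moreover have "card (undirected_edges D opp) < card (verts G)"
  proof -
    have "undirected_edges D opp \<subset> undirected_edges G opp"
    proof
      show "undirected_edges D opp \<subseteq> undirected_edges G opp"
        by (auto simp: undirected_edges_def D)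
      have "es ! 0 \<notin> undirected_edges D opp" by (auto simp: undirected_edges_def D)
      then show "undirected_edges D opp \<noteq> undirected_edges G opp" using E by blast
    qed
    then have "card (undirected_edges D opp) < card (undirected_edges G opp)"
      using es by (metis List.finite_set psubset_card_mono)
    also have "\<dots> = card (verts G)" using es vs dist len by (metis distinct_card)
    finally show ?thesis .
  qed
  ultimately show False using D by (simp add: loopy_def)
qed

end

section \<open>The equivalences and the regular case\<close>

theorem theorem3p9:
  fixes G :: "('a, 'b) pre_digraph" and opp :: "'b \<Rightarrow> 'b"
  assumes "fin_opp_graph G opp" and "connected G"
  shows "(2 \<le> card (arcs G) \<longrightarrow>
            (one_loopy G opp \<longleftrightarrow> strongly_connected (irr_digraph G opp)) \<and>
            (strongly_connected (irr_digraph G opp) \<longleftrightarrow>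
               \<not> is_cycle_graph G opp \<and> (\<forall>v \<in> verts G. 2 \<le> out_degree G v)))
       \<and> (\<forall>d. 3 \<le> d \<and> regular_graph G d \<longrightarrow> strongly_connected (irr_digraph G opp))"
proof -
  interpret fin_opp_graph G opp by fact
  note conn = \<open>connected G\<close>
  have "strongly_connected (irr_digraph G opp)" if d: "3 \<le> d" "regular_graph G d" for d
  proof -
    obtain v where v: "v \<in> verts G" using conn connected_iff_closed_sets by blast
    have deg: "3 \<le> out_degree G w" if "w \<in> verts G" for w
      using d that by (simp add: regular_graph_def)
    \<comment> \<open>A single vertex of degree at least 3 already supplies the two arcs required by
      the equivalence.\<close>
    have "out_degree G v \<le> card (arcs G)"
      unfolding out_degree_def by (rule card_mono) auto
    then have "2 \<le> card (arcs G)" using deg[OF v] by simp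
    moreover have "\<not> is_cycle_graph G opp"
      using is_cycle_regular(1)[OF _ _ v] deg v by fastforce
    ultimately show ?thesis
      using strongly_connected_irr_iff_not_cycle[OF conn] deg by fastforce
  qed
  moreover have "one_loopy G opp \<longleftrightarrow> strongly_connected (irr_digraph G opp)"
    if arcs: "2 \<le> card (arcs G)"
    using strongly_connected_irr_imp_one_loopy[OF conn arcs] one_loopy_degree[OF conn arcs]
      one_loopy_not_cycle strongly_connected_irr_iff_not_cycle[OF conn arcs] by blast
  ultimately show ?thesis using strongly_connected_irr_iff_not_cycle[OF conn] by blast
qed

end
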